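(* Let $\rho_0:\mathbb{N}\to[0,\infty)$ satisfy $m_2(\rho_0)=\sum_{j=1}^\infty j^2\rho_0(j)<+\infty$ and $m_1(\rho_0)=\sum_{j=1}^\infty j\rho_0(j)=m\in(0,1]$. Consider the discrete Coagulation-Fragmentation equation with kernels $a(j,k)=jk$ and $b(j,k)=1$. Then there exists at most one mass-conserving solution $\rho:\mathbb{N}\times[0,\infty)\to[0,\infty)$ with $\rho(\cdot,0)=\rho_0$.
   Context: Here $\mathbb{N}=\{1,2,3,\dots\}$. The discrete Coagulation-Fragmentation equation with kernels $a(j,k)=jk$, $b(j,k)=1$ and initial data $\rho_0$ is, for $j\in\mathbb{N}$, $t>0$, $$\rho_t(j,t)=\frac12\sum_{k=1}^{j-1}(j-k)k\,\rho(j-k,t)\rho(k,t)-\rho(j,t)\sum_{k=1}^\infty jk\,\rho(k,t)-\frac12(j-1)\rho(j,t)+\sum_{k=1}^\infty\rho(j+k,t),\qquad \rho(j,0)=\rho_0(j).$$ A function $\rho:\mathbb{N}\times[0,\infty)\to[0,\infty)$ is called a solution if $\rho(\cdot,0)=\rho_0$ and for every bounded $g:\mathbb{N}\to\mathbb{R}$, $$\frac{d}{dt}\sum_{j=1}^\infty g(j)\rho(j,t)=\frac12\sum_{j=1}^\infty\sum_{k=1}^\infty\big(g(j+k)-g(j)-g(k)\big)jk\,\rho(j,t)\rho(k,t)-\frac12\sum_{j=1}^\infty\sum_{k=1}^{j-1}\big(g(j)-g(k)-g(j-k)\big)\rho(j,t).$$ The solution is mass-conserving if $m_1(t)=\sum_{j=1}^\infty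 j\rho(j,t)$ equals $m_1(\rho_0)$ for all $t\ge0$. *)

theory Defs
  imports "HOL-Analysis.Analysis"
begin

text \<open>The positive integers are encoded as \<^term>\<open>{1..} :: nat set\<close>; values of a density at
  index \<open>0\<close> or at negative times are never used.\<close>

text \<open>Right-hand side of the weak formulation, with coagulation kernel \<open>a(j,k) = j * k\<close> and
  fragmentation kernel \<open>b(j,k) = 1\<close>, for a density \<open>r\<close> at a fixed time.\<close>

definition coag_term :: "(nat \<Rightarrow> real) \<Rightarrow> (nat \<Rightarrow> real) \<Rightarrow> real" where
  "coag_term g r =
     1 / 2 * (\<Sum>\<^sub>\<infinity>j\<in>{1..}. \<Sum>\<^sub>\<infinity>k\<in>{1..}.
       (g (j + k) - g j - g k) * (real j * real k) * r j * r k)"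

definition frag_term :: "(nat \<Rightarrow> real) \<Rightarrow> (nat \<Rightarrow> real) \<Rightarrow> real" where
  "frag_term g r =
     1 / 2 * (\<Sum>\<^sub>\<infinity>j\<in>{1..}. \<Sum>k\<in>{1..<j}. (g j - g k - g (j - k)) * r j)"

text \<open>The summability clause is the convergence of the coagulation term for \<open>g = 1\<close>, which is
  minus half the square of the first moment; conversely it makes every series below absolutely
  convergent. The differential identity is imposed for \<open>t > 0\<close>, and the initial value is linked
  to it by continuity at \<open>t = 0\<close>. For mass-conserving densities this is equivalent to imposing the
  identity on \<open>[0,\<infinity>)\<close> with the one-sided derivative at \<open>0\<close>.\<close>

definition cf_solution :: "(nat \<Rightarrow> real) \<Rightarrow> (nat \<Rightarrow> real \<Rightarrow> real) \<Rightarrow> bool" where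
  "cf_solution \<rho>0 \<rho> \<longleftrightarrow>
     (\<forall>j\<ge>1. \<forall>t\<ge>0. 0 \<le> \<rho> j t) \<and>
     (\<forall>j\<ge>1. \<rho> j 0 = \<rho>0 j) \<and>
     (\<forall>t\<ge>0. (\<lambda>j. real j * \<rho> j t) summable_on {1..}) \<and>
     (\<forall>g. bounded (g ` {1..}) \<longrightarrow>
        continuous_on {0..} (\<lambda>t. \<Sum>\<^sub>\<infinity>j\<in>{1..}. g j * \<rho> j t) \<and>
        (\<forall>t>0. ((\<lambda>s. \<Sum>\<^sub>\<infinity>j\<in>{1..}. g j * \<rho> j s) has_real_derivative
                 coag_term g (\<lambda>j. \<rho> j t) - frag_term g (\<lambda>j. \<rho> j t)) (at t)))"

definition mass_conserving :: "(nat \<Rightarrow> real) \<Rightarrow> (nat \<Rightarrow> real \<Rightarrow> real) \<Rightarrow> bool" where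
  "mass_conserving \<rho>0 \<rho> \<longleftrightarrow>
     (\<forall>t\<ge>0. ((\<lambda>j. real j * \<rho> j t) has_sum (\<Sum>\<^sub>\<infinity>j\<in>{1..}. real j * \<rho>0 j)) {1..})"

end

theory Submission
  imports Defs
begin

text \<open>Testing the equation with \<open>g j = 1 - q ^ j\<close> for \<open>q \<in> [0,1)\<close>, i.e. taking the Bernstein
  transform \<open>F(q,t) = \<Sum>j. (1 - q ^ j) * \<rho> j t\<close> (where \<open>q = exp (-x)\<close> in the usual variable \<open>x\<close>),
  turns a solution of constant mass \<open>m\<close> into a solution of the Hamilton--Jacobi equation
  \<open>F\<^sub>t = - (m - D)\<^sup>2 / 2 + (m + D) / 2 - (1 + q) / (2 * (1 - q)) * F\<close> with \<open>D = - q * F\<^sub>q\<close>.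
  For two solutions \<open>F\<close>, \<open>G\<close> with the same initial value, suppose that \<open>W = F - G\<close> has a positive
  maximum over \<open>[0,1] \<times> [0,T]\<close>. As \<open>W = 0\<close> for \<open>q = 1\<close> and for \<open>t = 0\<close>, the maximum is attained
  at \<open>q < 1\<close> and \<open>t > 0\<close>. There the two values of \<open>D\<close> agree, because \<open>W\<^sub>q = 0\<close> or \<open>q = 0\<close>, so
  \<open>W\<^sub>t = - (1 + q) / (2 * (1 - q)) * W < 0\<close>, whereas \<open>W\<^sub>t \<ge> 0\<close> at a maximum.\<close>

definition bernstein :: "(nat \<Rightarrow> real) \<Rightarrow> real \<Rightarrow> real" where
  "bernstein r q = (\<Sum>\<^sub>\<infinity>j\<in>{1..}. (1 - q ^ j) * r j)"

text \<open>The quantity \<open>D\<close> of the overview, i.e. the derivative of the Bernstein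
  transform in \<open>x = - ln q\<close>. Encoding it as a series gives it a value at
  \<open>q = 0\<close> too.\<close>

definition tilted_mass :: "(nat \<Rightarrow> real) \<Rightarrow> real \<Rightarrow> real" where
  "tilted_mass r q = (\<Sum>\<^sub>\<infinity>j\<in>{1..}. real j * q ^ j * r j)"

section \<open>Series controlled by the first moment\<close>

lemma has_sum_diff:
  fixes f g :: "'a \<Rightarrow> real"
  assumes "(f has_sum a) A" and "(g has_sum b) A"
  shows "((\<lambda>x. f x - g x) has_sum (a - b)) A"
  using has_sum_add[OF assms(1), of "\<lambda>x. - g x" "- b"] assms(2) by (simp add: has_sum_uminus)

lemma summable_on_mult_bounded_by_index:
  fixes r c :: "nat \<Rightarrow> real"
  assumes r: "\<And>j. j \<ge> 1 \<Longrightarrow> 0 \<le> r j"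
    and s: "(\<lambda>j. real j * r j) summable_on {1..}"
    and c: "\<And>j. j \<ge> 1 \<Longrightarrow> \<bar>c j\<bar> \<le> C * real j"
  shows "(\<lambda>j. c j * r j) summable_on {1..}"
proof -
  have "(\<lambda>j. C * (real j * r j)) summable_on {1..}"
    using s by (rule summable_on_cmult_right)
  then have "(\<lambda>j. norm (c j * r j)) summable_on {1..}"
  proof (rule summable_on_comparison_test)
    fix j :: nat assume "j \<in> {1..}"
    then show "norm (c j * r j) \<le> C * (real j * r j)"
      using mult_right_mono[OF c[of j] r[of j]] r[of j] by (simp add: abs_mult mult.assoc)
  qed auto
  then show ?thesis by (rule abs_summable_summable)
qed

lemma power_le_index:
  fixes q :: real
  assumes "0 \<le> q" "q \<le> 1" "j \<ge> 1"
  shows "\<bar>q ^ j\<bar> \<le> 1 * real j"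
  using power_le_one[OF assms(1,2), of j] assms by simp

lemma abs_power_diff_le:
  fixes p q :: real
  assumes "0 \<le> p" "p \<le> 1" "0 \<le> q" "q \<le> 1"
  shows "\<bar>p ^ j - q ^ j\<bar> \<le> real j * \<bar>p - q\<bar>"
  using norm_power_diff[of p q j] assms by simp

lemma summable_on_bernstein:
  fixes r :: "nat \<Rightarrow> real" and q :: real
  assumes r: "\<And>j. j \<ge> 1 \<Longrightarrow> 0 \<le> r j"
    and s: "(\<lambda>j. real j * r j) summable_on {1..}"
    and q: "0 \<le> q" "q \<le> 1"
  shows "(\<lambda>j. (1 - q ^ j) * r j) summable_on {1..}"
proof (rule summable_on_mult_bounded_by_index[OF r s, where C = 1])
  fix j :: nat assume "j \<ge> 1"
  moreover have "0 \<le> q ^ j" "q ^ j \<le> 1" using q by (auto intro: power_le_one)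
  ultimately show "\<bar>1 - q ^ j\<bar> \<le> 1 * real j" by linarith
qed auto

lemma summable_on_tilted_mass:
  fixes r :: "nat \<Rightarrow> real" and q :: real
  assumes r: "\<And>j. j \<ge> 1 \<Longrightarrow> 0 \<le> r j"
    and s: "(\<lambda>j. real j * r j) summable_on {1..}"
    and q: "0 \<le> q" "q \<le> 1"
  shows "(\<lambda>j. real j * q ^ j * r j) summable_on {1..}"
  by (rule summable_on_mult_bounded_by_index[OF r s, where C = 1])
     (use q power_le_one[OF q] in \<open>auto simp: abs_mult mult_left_le\<close>)

text \<open>Termwise, \<open>q ^ j\<close> is Lipschitz on \<open>[0,1]\<close> with constant
  \<open>j\<close>, so the mass is a Lipschitz constant for the sum. For constant mass this bound is
  uniform in time.\<close>

lemma bernstein_lipschitz: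
  fixes r :: "nat \<Rightarrow> real" and p q :: real
  assumes r: "\<And>j. j \<ge> 1 \<Longrightarrow> 0 \<le> r j"
    and s: "((\<lambda>j. real j * r j) has_sum m) {1..}"
    and p: "0 \<le> p" "p \<le> 1" and q: "0 \<le> q" "q \<le> 1"
  shows "\<bar>bernstein r p - bernstein r q\<bar> \<le> m * \<bar>p - q\<bar>"
proof -
  note s' = has_sum_imp_summable[OF s]
  have "((\<lambda>j. (1 - p ^ j) * r j - (1 - q ^ j) * r j) has_sum bernstein r p - bernstein r q) {1..}"
    unfolding bernstein_def
    by (intro has_sum_diff has_sum_infsum summable_on_bernstein r s' p q)
  moreover have "((\<lambda>j. real j * r j * \<bar>p - q\<bar>) has_sum m * \<bar>p - q\<bar>) {1..}"
    using s by (rule has_sum_cmult_left)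
  ultimately have "norm (bernstein r p - bernstein r q) \<le> m * \<bar>p - q\<bar>"
  proof (rule norm_infsum_le)
    fix j :: nat assume "j \<in> {1..}"
    then have "\<bar>q ^ j - p ^ j\<bar> * r j \<le> (real j * \<bar>p - q\<bar>) * r j"
      using abs_power_diff_le[OF q p, of j] r[of j]
      by (intro mult_right_mono) (auto simp: abs_minus_commute)
    moreover have "(1 - p ^ j) * r j - (1 - q ^ j) * r j = (q ^ j - p ^ j) * r j"
      by (simp add: algebra_simps)
    ultimately show "norm ((1 - p ^ j) * r j - (1 - q ^ j) * r j) \<le> real j * r j * \<bar>p - q\<bar>"
      using \<open>j \<in> {1..}\<close> r[of j] by (simp only: real_norm_def abs_mult) (simp add: mult_ac)
  qed
  then show ?thesis by simp
qed

section \<open>Power series in \<open>q\<close>: differentiation and injectivity\<close>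

lemma sums_infsum_atLeast_1:
  fixes f :: "nat \<Rightarrow> real"
  assumes "f summable_on {1..}"
  shows "(\<lambda>n. if n = 0 then 0 else f n) sums infsum f {1..}"
proof -
  have "((\<lambda>n. if n = 0 then 0 else f n) has_sum infsum f {1..}) UNIV"
    using has_sum_infsum[OF assms]
    by (rule has_sum_cong_neutral[THEN iffD1, rotated -1]) auto
  then show ?thesis by (rule has_sum_imp_sums)
qed

lemma bernstein_sums:
  fixes r :: "nat \<Rightarrow> real" and q :: real
  assumes r: "\<And>j. j \<ge> 1 \<Longrightarrow> 0 \<le> r j"
    and s: "(\<lambda>j. real j * r j) summable_on {1..}"
    and q: "0 \<le> q" "q \<le> 1"
  shows "(\<lambda>n. (if n = 0 then 0 else r n) * q ^ n) sums (bernstein r 0 - bernstein r q)"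
proof -
  have "((\<lambda>j. (1 - 0 ^ j) * r j - (1 - q ^ j) * r j) has_sum (bernstein r 0 - bernstein r q)) {1..}"
    unfolding bernstein_def
    by (intro has_sum_diff has_sum_infsum summable_on_bernstein r s q) auto
  also have "?this \<longleftrightarrow> ((\<lambda>j. q ^ j * r j) has_sum (bernstein r 0 - bernstein r q)) {1..}"
    by (rule has_sum_cong) (auto simp: algebra_simps)
  finally have "(\<Sum>\<^sub>\<infinity>j\<in>{1..}. q ^ j * r j) = bernstein r 0 - bernstein r q" by (rule infsumI)
  moreover have "(\<lambda>j. q ^ j * r j) summable_on {1..}"
    by (rule summable_on_mult_bounded_by_index[OF r s power_le_index[OF q]])
  ultimately have "(\<lambda>n. if n = 0 then 0 else q ^ n * r n) sums (bernstein r 0 - bernstein r q)"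
    using sums_infsum_atLeast_1 by metis
  then show ?thesis by (rule sums_cong[THEN iffD1, rotated]) auto
qed

lemma bernstein_has_derivative:
  fixes r :: "nat \<Rightarrow> real" and q :: real
  assumes r: "\<And>j. j \<ge> 1 \<Longrightarrow> 0 \<le> r j"
    and s: "(\<lambda>j. real j * r j) summable_on {1..}"
    and q: "0 < q" "q < 1"
  shows "(bernstein r has_real_derivative - tilted_mass r q / q) (at q)"
proof -
  define a where "a = (\<lambda>n. if n = 0 then 0 else r n)"
  have powser: "(\<lambda>n. a n * x ^ n) sums (bernstein r 0 - bernstein r x)" if "0 \<le> x" "x \<le> 1" for x
    unfolding a_def by (rule bernstein_sums[OF r s that])
  \<comment> \<open>Convergence at the endpoint 1 permits termwise differentiation for
    \<open>0 < q < 1\<close>.\<close>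
  have deriv: "((\<lambda>x. \<Sum>n. a n * x ^ n) has_real_derivative (\<Sum>n. diffs a n * q ^ n)) (at q)"
    using powser[of 1] q by (intro termdiffs_strong[where K = 1]) (auto simp: sums_iff)
  have "(\<lambda>n. if n = 0 then 0 else real n * q ^ n * r n) sums tilted_mass r q"
    unfolding tilted_mass_def using q
    by (intro sums_infsum_atLeast_1 summable_on_tilted_mass r s) auto
  \<comment> \<open>The term of index 0 vanishes, so the shift keeps the sum; dividing by
    \<open>q\<close> then lowers the exponents to those of \<open>diffs\<close>.\<close>
  then have "(\<lambda>n. real (Suc n) * q ^ Suc n * r (Suc n)) sums tilted_mass r q"
    using sums_Suc_iff[of "\<lambda>n. if n = 0 then 0 else real n * q ^ n * r n" "tilted_mass r q"]
    by simp
  from sums_divide[OF this, of q] have "(\<lambda>n. diffs a n * q ^ n) sums (tilted_mass r q / q)"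
    using q by (simp add: diffs_def a_def mult_ac)
  with DERIV_diff[OF DERIV_const deriv, of "bernstein r 0"]
  have "((\<lambda>x. bernstein r 0 - (\<Sum>n. a n * x ^ n)) has_real_derivative
      - tilted_mass r q / q) (at q)"
    by (auto simp: sums_iff)
  then show ?thesis
  proof (rule has_field_derivative_transform_within_open[where S = "{0<..<1}"])
    fix x :: real assume "x \<in> {0<..<1}"
    then show "bernstein r 0 - (\<Sum>n. a n * x ^ n) = bernstein r x"
      using powser[of x] by (auto simp: sums_iff)
  qed (use q in auto)
qed

text \<open>Equal transforms have equal generating functions on \<open>[0,1]\<close>; the
  coefficients of the difference then vanish one after another, by letting the variable tend to
  0.\<close>

lemma bernstein_determines:
  fixes r s :: "nat \<Rightarrow> real"
  assumes r: "\<And>j. j \<ge> 1 \<Longrightarrow> 0 \<le> r j" "(\<lambda>j. real j * r j) summable_on {1..}"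
    and s: "\<And>j. j \<ge> 1 \<Longrightarrow> 0 \<le> s j" "(\<lambda>j. real j * s j) summable_on {1..}"
    and eq: "\<And>q. 0 \<le> q \<Longrightarrow> q \<le> 1 \<Longrightarrow> bernstein r q = bernstein s q"
    and j: "j \<ge> 1"
  shows "r j = s j"
proof -
  define d where "d = (\<lambda>n. (if n = 0 then 0 else r n) - (if n = 0 then 0 else s n))"
  have d0: "(\<lambda>n. d n * x ^ n) sums 0" if "0 \<le> x" "x \<le> 1" for x
    using sums_diff[OF bernstein_sums[OF r that] bernstein_sums[OF s that]]
      eq[OF that] eq[of 0] by (simp add: d_def left_diff_distrib)
  have "d n = 0" for n
  proof (induction n rule: less_induct)
    case (less n)
    \<comment> \<open>By induction the coefficients below \<open>n\<close> are 0, so dividing by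
      \<open>x ^ n\<close> leaves a series with constant term \<open>d n\<close>.\<close>
    have shifted: "(\<lambda>k. d (k + n) * x ^ k) sums 0" if x: "0 < x" "x \<le> 1" for x
    proof -
      have "(\<lambda>k. d (k + n) * x ^ (k + n)) sums (0 - (\<Sum>k<n. d k * x ^ k))"
        using x by (intro sums_split_initial_segment d0) auto
      then have "(\<lambda>k. d (k + n) * x ^ (k + n) / x ^ n) sums ((0 - (\<Sum>k<n. d k * x ^ k)) / x ^ n)"
        by (rule sums_divide)
      then show ?thesis using x less by (simp add: power_add)
    qed
    have "isCont (\<lambda>x. \<Sum>k. d (k + n) * x ^ k) 0"
      using shifted[of 1] by (intro isCont_powser[where K = 1]) (auto simp: sums_iff)
    \<comment> \<open>The limit is taken from the right because the sum is known to vanish only for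
      positive \<open>x\<close>.\<close>
    then have "((\<lambda>x. \<Sum>k. d (k + n) * x ^ k) \<longlongrightarrow> d n) (at_right 0)"
      by (auto simp: isCont_def filterlim_at_split)
    moreover have "eventually (\<lambda>x::real. 0 < x \<and> x < 1) (at_right 0)"
      by (auto simp: eventually_at_right_less eventually_at_right_field intro: exI[of _ 1])
    then have "eventually (\<lambda>x. (\<Sum>k. d (k + n) * x ^ k) = 0) (at_right 0)"
      by eventually_elim (use shifted in \<open>auto simp: sums_iff\<close>)
    ultimately have "((\<lambda>x::real. 0::real) \<longlongrightarrow> d n) (at_right 0)"
      using tendsto_cong by fast
    then show ?case
      using tendsto_unique[OF trivial_limit_at_right_real _ tendsto_const] by fastforce
  qed
  then have "d j = 0" .
  with j show ?thesis by (simp add: d_def)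
qed

section \<open>The weak formulation tested with \<open>1 - q ^ j\<close>\<close>

text \<open>For this \<open>g\<close>, \<open>g (j + k) - g j - g k = - g j * g k\<close>; with the
  product kernel the double sum becomes minus the square of a single sum.\<close>

lemma coag_term_bernstein:
  fixes r :: "nat \<Rightarrow> real" and q :: real
  assumes r: "\<And>j. j \<ge> 1 \<Longrightarrow> 0 \<le> r j"
    and s: "((\<lambda>j. real j * r j) has_sum m) {1..}"
    and q: "0 \<le> q" "q \<le> 1"
  shows "coag_term (\<lambda>j. 1 - q ^ j) r = - (m - tilted_mass r q)\<^sup>2 / 2"
proof -
  define c where "c = (\<lambda>j. (1 - q ^ j) * real j * r j)"
  have "(c has_sum (m - tilted_mass r q)) {1..}"
    using has_sum_diff[OF s has_sum_infsum[OF summable_on_tilted_mass[OF r has_sum_imp_summable[OF s] q]]]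
    by (simp add: tilted_mass_def c_def algebra_simps)
  then have c: "infsum c {1..} = m - tilted_mass r q" by (rule infsumI)
  have "(1 - q ^ (j + k) - (1 - q ^ j) - (1 - q ^ k)) * (real j * real k) * r j * r k = - c j * c k"
    for j k
    by (simp add: c_def power_add algebra_simps)
  then have "coag_term (\<lambda>j. 1 - q ^ j) r = 1 / 2 * (\<Sum>\<^sub>\<infinity>j\<in>{1..}. \<Sum>\<^sub>\<infinity>k\<in>{1..}. - c j * c k)"
    unfolding coag_term_def by simp
  also have "\<dots> = 1 / 2 * (\<Sum>\<^sub>\<infinity>j\<in>{1..}. - (c j * (m - tilted_mass r q)))"
    by (subst infsum_cmult_right') (simp only: c mult_minus_left)
  also have "\<dots> = - (m - tilted_mass r q)\<^sup>2 / 2"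
    by (simp add: infsum_cmult_left' infsum_uminus c power2_eq_square del: One_nat_def)
  finally show ?thesis .
qed

text \<open>A geometric sum, arranged so that after weighting by \<open>r j\<close> the three pieces
  sum to the transform, the mass and the tilted mass.\<close>

lemma frag_summand_bernstein:
  fixes q :: real
  assumes q: "q \<noteq> 1" and j: "j \<ge> 1"
  shows "(\<Sum>k\<in>{1..<j}. (1 - q ^ j) - (1 - q ^ k) - (1 - q ^ (j - k))) =
    (1 + q) / (1 - q) * (1 - q ^ j) - (real j + real j * q ^ j)"
proof -
  have rev: "(\<Sum>k\<in>{1..<j}. q ^ (j - k)) = (\<Sum>k\<in>{1..<j}. q ^ k)"
    by (rule sum.reindex_bij_witness[of _ "\<lambda>k. j - k" "\<lambda>k. j - k"]) auto
  have geom: "(\<Sum>k\<in>{1..<j}. q ^ k) = (q - q ^ j) / (1 - q)"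
    using j
  proof (induction j rule: dec_induct)
    case (step n)
    then have "(\<Sum>k\<in>{1..<Suc n}. q ^ k) = (q - q ^ n) / (1 - q) + q ^ n" by simp
    also have "\<dots> = (q - q ^ Suc n) / (1 - q)" using q by (simp add: divide_simps) algebra
    finally show ?case .
  qed simp
  have "(\<Sum>k\<in>{1..<j}. (1 - q ^ j) - (1 - q ^ k) - (1 - q ^ (j - k))) =
      (\<Sum>k\<in>{1..<j}. q ^ k + q ^ (j - k) - (1 + q ^ j))"
    by (rule sum.cong) auto
  also have "\<dots> = 2 * ((q - q ^ j) / (1 - q)) - (real j - 1) * (1 + q ^ j)"
    using j by (simp add: sum.distrib sum_subtractf rev geom of_nat_diff del: One_nat_def)
  also have "\<dots> = (1 + q) / (1 - q) * (1 - q ^ j) - (real j + real j * q ^ j)"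
    using q by (simp add: divide_simps) algebra
  finally show ?thesis .
qed

lemma frag_term_bernstein:
  fixes r :: "nat \<Rightarrow> real" and q :: real
  assumes r: "\<And>j. j \<ge> 1 \<Longrightarrow> 0 \<le> r j"
    and s: "((\<lambda>j. real j * r j) has_sum m) {1..}"
    and q: "0 \<le> q" "q < 1"
  shows "frag_term (\<lambda>j. 1 - q ^ j) r =
    ((1 + q) / (1 - q) * bernstein r q - (m + tilted_mass r q)) / 2"
proof -
  note s' = has_sum_imp_summable[OF s]
  have hs: "((\<lambda>j. (1 + q) / (1 - q) * ((1 - q ^ j) * r j) - (real j * r j + real j * q ^ j * r j))
      has_sum ((1 + q) / (1 - q) * bernstein r q - (m + tilted_mass r q))) {1..}"
    unfolding bernstein_def tilted_mass_def using q
    by (intro has_sum_diff has_sum_add has_sum_cmult_right s has_sum_infsum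
        summable_on_bernstein summable_on_tilted_mass r s') auto
  have summand: "(\<Sum>k\<in>{1..<j}. ((1 - q ^ j) - (1 - q ^ k) - (1 - q ^ (j - k))) * r j) =
      (1 + q) / (1 - q) * ((1 - q ^ j) * r j) - (real j * r j + real j * q ^ j * r j)"
    if "j \<in> {1..}" for j
  proof -
    have "(\<Sum>k\<in>{1..<j}. ((1 - q ^ j) - (1 - q ^ k) - (1 - q ^ (j - k))) * r j) =
        ((1 + q) / (1 - q) * (1 - q ^ j) - (real j + real j * q ^ j)) * r j"
      by (subst frag_summand_bernstein[symmetric]) (use that q in \<open>auto simp: sum_distrib_right\<close>)
    then show ?thesis by (simp only: left_diff_distrib distrib_right mult.assoc)
  qed
  have "(\<Sum>\<^sub>\<infinity>j\<in>{1..}. \<Sum>k\<in>{1..<j}. ((1 - q ^ j) - (1 - q ^ k) - (1 - q ^ (j - k))) * r j) =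
      (1 + q) / (1 - q) * bernstein r q - (m + tilted_mass r q)"
    using infsum_cong[OF summand] infsumI[OF hs] by (rule trans)
  then show ?thesis unfolding frag_term_def by simp
qed

lemma bounded_bernstein_test:
  fixes q :: real
  assumes "0 \<le> q" "q \<le> 1"
  shows "bounded ((\<lambda>j. 1 - q ^ j) ` A)"
  unfolding bounded_iff using power_le_one[OF assms] assms by (intro exI[of _ 1]) auto

text \<open>The test function is bounded, hence admissible. Since \<open>m\<close> does not depend
  on time, the solution enters the right-hand side only through \<open>F\<close> and
  \<open>D\<close>.\<close>

lemma bernstein_hamilton_jacobi:
  fixes \<rho> :: "nat \<Rightarrow> real \<Rightarrow> real"
  assumes sol: "cf_solution \<rho>0 \<rho>"
    and mass: "\<And>t. t \<ge> 0 \<Longrightarrow> ((\<lambda>j. real j * \<rho> j t) has_sum m) {1..}"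
    and q: "0 \<le> q" "q < 1" and t: "t > 0"
  shows "((\<lambda>s. bernstein (\<lambda>j. \<rho> j s) q) has_real_derivative
    - (m - tilted_mass (\<lambda>j. \<rho> j t) q)\<^sup>2 / 2 + (m + tilted_mass (\<lambda>j. \<rho> j t) q) / 2
      - (1 + q) / (1 - q) * bernstein (\<lambda>j. \<rho> j t) q / 2) (at t)"
proof -
  have nonneg: "0 \<le> \<rho> j t" if "j \<ge> 1" for j
    using sol that t by (simp add: cf_solution_def)
  have m: "((\<lambda>j. real j * \<rho> j t) has_sum m) {1..}" using mass t by simp
  have "((\<lambda>s. bernstein (\<lambda>j. \<rho> j s) q) has_real_derivative
      coag_term (\<lambda>j. 1 - q ^ j) (\<lambda>j. \<rho> j t) - frag_term (\<lambda>j. 1 - q ^ j) (\<lambda>j. \<rho> j t)) (at t)"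
    using sol bounded_bernstein_test[of q "{1..}"] q t
    unfolding cf_solution_def bernstein_def by auto
  moreover have "coag_term (\<lambda>j. 1 - q ^ j) (\<lambda>j. \<rho> j t) - frag_term (\<lambda>j. 1 - q ^ j) (\<lambda>j. \<rho> j t) =
      - (m - tilted_mass (\<lambda>j. \<rho> j t) q)\<^sup>2 / 2 + (m + tilted_mass (\<lambda>j. \<rho> j t) q) / 2
      - (1 + q) / (1 - q) * bernstein (\<lambda>j. \<rho> j t) q / 2"
    using coag_term_bernstein[OF nonneg m, of q] frag_term_bernstein[OF nonneg m q] q
    by (simp add: diff_divide_distrib)
  ultimately show ?thesis by simp
qed

section \<open>Maximum principle and uniqueness\<close>

text \<open>Continuity in \<open>t\<close> for each \<open>q\<close>, combined with a Lipschitz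
  bound in \<open>q\<close> uniform in \<open>t\<close>, gives the joint continuity that makes the
  maximum in the comparison attained.\<close>

lemma continuous_on_bernstein:
  fixes \<rho> :: "nat \<Rightarrow> real \<Rightarrow> real"
  assumes sol: "cf_solution \<rho>0 \<rho>"
    and mass: "\<And>t. t \<ge> 0 \<Longrightarrow> ((\<lambda>j. real j * \<rho> j t) has_sum m) {1..}"
  shows "continuous_on ({0..1} \<times> {0..}) (\<lambda>(q, t). bernstein (\<lambda>j. \<rho> j t) q)"
proof -
  define F where "F = (\<lambda>q t. bernstein (\<lambda>j. \<rho> j t) q)"
  have lip: "\<bar>F p t - F q t\<bar> \<le> m * \<bar>p - q\<bar>"
    if "0 \<le> p" "p \<le> 1" "0 \<le> q" "q \<le> 1" "0 \<le> t" for p q t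
    unfolding F_def using sol that by (intro bernstein_lipschitz mass) (auto simp: cf_solution_def)
  have cont: "continuous_on {0..} (F q)" if "0 \<le> q" "q \<le> 1" for q
    using sol bounded_bernstein_test[OF that] by (auto simp: cf_solution_def bernstein_def F_def)
  have "((\<lambda>(p, s). F p s) \<longlongrightarrow> F q t) (at (q, t) within {0..1} \<times> {0..})"
    if q: "0 \<le> q" "q \<le> 1" and t: "0 \<le> t" for q t
  proof -
    let ?A = "at (q, t) within {0..1} \<times> {0::real..}"
    have "continuous_on ({0..1} \<times> {0::real..}) (\<lambda>x. F q (snd x))"
      by (rule continuous_on_compose2[OF cont[OF q]]) (auto intro: continuous_intros)
    then have "((\<lambda>x. F q (snd x)) \<longlongrightarrow> F q t) ?A"
      using q t by (auto simp: continuous_on)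
    moreover have "((\<lambda>x. (\<lambda>(p, s). F p s) x - F q (snd x)) \<longlongrightarrow> 0) ?A"
    proof (rule Lim_null_comparison)
      have "((\<lambda>x. m * \<bar>fst x - q\<bar>) \<longlongrightarrow> m * \<bar>fst (q, t) - q\<bar>) ?A"
        by (intro tendsto_intros)
      then show "((\<lambda>x. m * \<bar>fst x - q\<bar>) \<longlongrightarrow> 0) ?A" by simp
      show "eventually (\<lambda>x. norm ((\<lambda>(p, s). F p s) x - F q (snd x)) \<le> m * \<bar>fst x - q\<bar>) ?A"
        using q by (auto simp: eventually_at_filter intro!: always_eventually lip)
    qed
    ultimately have "((\<lambda>x. F q (snd x) + ((\<lambda>(p, s). F p s) x - F q (snd x))) \<longlongrightarrow> F q t + 0) ?A"
      by (rule tendsto_add)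
    then show ?thesis by (simp add: case_prod_unfold)
  qed
  then show ?thesis by (auto simp: continuous_on F_def)
qed

lemma bernstein_comparison:
  fixes \<rho> \<sigma> :: "nat \<Rightarrow> real \<Rightarrow> real"
  assumes \<rho>: "cf_solution \<rho>0 \<rho>" "\<And>t. t \<ge> 0 \<Longrightarrow> ((\<lambda>j. real j * \<rho> j t) has_sum m) {1..}"
    and \<sigma>: "cf_solution \<sigma>0 \<sigma>" "\<And>t. t \<ge> 0 \<Longrightarrow> ((\<lambda>j. real j * \<sigma> j t) has_sum m) {1..}"
    and init: "\<And>q. 0 \<le> q \<Longrightarrow> q \<le> 1 \<Longrightarrow> bernstein \<rho>0 q \<le> bernstein \<sigma>0 q"
    and q: "0 \<le> q" "q \<le> 1" and t: "0 \<le> t"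
  shows "bernstein (\<lambda>j. \<rho> j t) q \<le> bernstein (\<lambda>j. \<sigma> j t) q"
proof (rule ccontr)
  assume pos: "\<not> bernstein (\<lambda>j. \<rho> j t) q \<le> bernstein (\<lambda>j. \<sigma> j t) q"
  define W where "W = (\<lambda>p s. bernstein (\<lambda>j. \<rho> j s) p - bernstein (\<lambda>j. \<sigma> j s) p)"
  have "continuous_on ({0..1} \<times> {0..t}) (\<lambda>(p, s). W p s)"
    unfolding W_def case_prod_unfold
    by (intro continuous_on_diff
        continuous_on_subset[OF continuous_on_bernstein[OF \<rho>, unfolded case_prod_unfold]]
        continuous_on_subset[OF continuous_on_bernstein[OF \<sigma>, unfolded case_prod_unfold]]) auto
  moreover have "compact ({0..1::real} \<times> {0..t})" by (intro compact_Times compact_Icc)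
  moreover have "{0..1::real} \<times> {0..t} \<noteq> {}" using t by auto
  ultimately obtain q0 t0 where mem: "0 \<le> q0" "q0 \<le> 1" "0 \<le> t0" "t0 \<le> t"
    and max: "\<And>p s. 0 \<le> p \<Longrightarrow> p \<le> 1 \<Longrightarrow> 0 \<le> s \<Longrightarrow> s \<le> t \<Longrightarrow> W p s \<le> W q0 t0"
    using continuous_attains_sup[of "{0..1} \<times> {0..t}" "\<lambda>(p, s). W p s"] by auto
  have W0: "W q0 t0 > 0"
    using pos max[OF q t order_refl] by (simp add: W_def)
  have "bernstein (\<lambda>j. \<rho> j 0) q0 = bernstein \<rho>0 q0" "bernstein (\<lambda>j. \<sigma> j 0) q0 = bernstein \<sigma>0 q0"
    using \<rho>(1) \<sigma>(1) by (auto simp: bernstein_def cf_solution_def intro: infsum_cong)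
  then have t0: "t0 > 0"
    using W0 init[OF mem(1,2)] mem(3) by (cases "t0 = 0") (auto simp: W_def)
  \<comment> \<open>Both transforms vanish at \<open>q = 1\<close>.\<close>
  have q0: "q0 < 1"
    using W0 mem(2) by (cases "q0 = 1") (auto simp: W_def bernstein_def)
  define D E where "D = tilted_mass (\<lambda>j. \<rho> j t0) q0" and "E = tilted_mass (\<lambda>j. \<sigma> j t0) q0"
  have "D = E"
  proof (cases "q0 = 0")
    \<comment> \<open>The maximum lies on the boundary, so \<open>W\<close> need not be stationary
      there; but every term of both series contains \<open>0 ^ j\<close> with
      \<open>j \<ge> 1\<close>.\<close>
    case True
    then show ?thesis unfolding D_def E_def tilted_mass_def by (intro infsum_cong) auto
  next
    case False
    then have q0': "0 < q0" using mem by simp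
    have "(bernstein (\<lambda>j. \<rho> j t0) has_real_derivative - D / q0) (at q0)"
      unfolding D_def using \<rho> q0 q0' t0
      by (intro bernstein_has_derivative) (auto simp: cf_solution_def)
    moreover have "(bernstein (\<lambda>j. \<sigma> j t0) has_real_derivative - E / q0) (at q0)"
      unfolding E_def using \<sigma> q0 q0' t0
      by (intro bernstein_has_derivative) (auto simp: cf_solution_def)
    ultimately have "((\<lambda>p. W p t0) has_real_derivative - D / q0 - (- E / q0)) (at q0)"
      unfolding W_def by (rule DERIV_diff)
    \<comment> \<open>This radius keeps \<open>p\<close> inside \<open>[0,1]\<close>, where the
      maximality of \<open>W q0 t0\<close> is known.\<close>
    moreover have "0 < min q0 (1 - q0)" using q0 q0' by simp
    moreover have "\<forall>p. \<bar>q0 - p\<bar> < min q0 (1 - q0) \<longrightarrow> W p t0 \<le> W q0 t0"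
      using mem by (auto intro!: max)
    ultimately have "- D / q0 - (- E / q0) = 0" by (rule DERIV_local_max)
    then show ?thesis using q0' by simp
  qed
  \<comment> \<open>With \<open>D = E\<close> the quadratic and linear terms cancel, leaving only
    the damping term.\<close>
  have W_t: "((\<lambda>s. W q0 s) has_real_derivative - ((1 + q0) / (1 - q0) * W q0 t0 / 2)) (at t0)"
  proof -
    note bernstein_hamilton_jacobi[OF \<rho> mem(1) q0 t0, folded D_def]
    moreover note bernstein_hamilton_jacobi[OF \<sigma> mem(1) q0 t0, folded E_def]
    ultimately have "((\<lambda>s. W q0 s) has_real_derivative
        (- (m - D)\<^sup>2 / 2 + (m + D) / 2 - (1 + q0) / (1 - q0) * bernstein (\<lambda>j. \<rho> j t0) q0 / 2) -
        (- (m - E)\<^sup>2 / 2 + (m + E) / 2 - (1 + q0) / (1 - q0) * bernstein (\<lambda>j. \<sigma> j t0) q0 / 2)) (at t0)"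
      unfolding W_def by (rule DERIV_diff)
    then show ?thesis
      by (rule DERIV_cong) (unfold W_def \<open>D = E\<close> right_diff_distrib diff_divide_distrib, linarith)
  qed
  \<comment> \<open>Only times before \<open>t0\<close> are compared, as \<open>t0\<close> may be
    the final time \<open>t\<close>.\<close>
  have "- ((1 + q0) / (1 - q0) * W q0 t0 / 2) < 0"
    using W0 q0 mem by simp
  from DERIV_neg_dec_left[OF W_t this] obtain d where d: "d > 0"
    and dec: "\<And>h. 0 < h \<Longrightarrow> h < d \<Longrightarrow> W q0 t0 < W q0 (t0 - h)" by blast
  define h where "h = min (d / 2) (t0 / 2)"
  have "0 < h" "h < d" "h \<le> t0" using d t0 by (auto simp: h_def)
  then show False
    using dec[of h] max[of q0 "t0 - h"] mem by simp
qed

theorem proposition1p2: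
  fixes \<rho>0 :: "nat \<Rightarrow> real" and m :: real and \<rho> \<sigma> :: "nat \<Rightarrow> real \<Rightarrow> real"
  assumes "\<And>j. j \<ge> 1 \<Longrightarrow> 0 \<le> \<rho>0 j"
    and "(\<lambda>j. (real j)\<^sup>2 * \<rho>0 j) summable_on {1..}"
    and "((\<lambda>j. real j * \<rho>0 j) has_sum m) {1..}"
    and "0 < m" and "m \<le> 1"
    and "cf_solution \<rho>0 \<rho>" and "mass_conserving \<rho>0 \<rho>"
    and "cf_solution \<rho>0 \<sigma>" and "mass_conserving \<rho>0 \<sigma>"
  shows "\<forall>j\<ge>1. \<forall>t\<ge>0. \<rho> j t = \<sigma> j t"
proof (intro allI impI)
  fix j :: nat and t :: real assume j: "j \<ge> 1" and t: "t \<ge> 0"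
  have \<rho>: "((\<lambda>j. real j * \<rho> j s) has_sum m) {1..}" if "s \<ge> 0" for s
    using assms(7) that infsumI[OF assms(3)] by (simp add: mass_conserving_def)
  have \<sigma>: "((\<lambda>j. real j * \<sigma> j s) has_sum m) {1..}" if "s \<ge> 0" for s
    using assms(9) that infsumI[OF assms(3)] by (simp add: mass_conserving_def)
  \<comment> \<open>The initial data coincide, so the comparison applies in both directions.\<close>
  have "bernstein (\<lambda>j. \<rho> j t) q = bernstein (\<lambda>j. \<sigma> j t) q" if "0 \<le> q" "q \<le> 1" for q
    using bernstein_comparison[OF assms(6) \<rho> assms(8) \<sigma> order_refl that t]
      bernstein_comparison[OF assms(8) \<sigma> assms(6) \<rho> order_refl that t] by (rule antisym)
  then show "\<rho> j t = \<sigma> j t"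
    using assms(6,8) t j
    by (intro bernstein_determines[of "\<lambda>j. \<rho> j t" "\<lambda>j. \<sigma> j t"]) (auto simp: cf_solution_def)
qed

end
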